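(* Let $X=(X^x)_{x\in\mathbb{R}}$ be a one-dimensional deterministic càdlàg Markov process. Then $X$ is a semimartingale if and only if for every $x\in\mathbb{R}$ the jumps of the path $t\mapsto X_t^x$ are locally absolutely summable, i.e. $\sum_{0<s\le T}|X_s^x-X_{s-}^x|<\infty$ for every $T>0$.
   Context: A deterministic (time homogeneous, universal) Markov process on $\mathbb{R}$ is a family $(X^x)_{x\in\mathbb{R}}$ of functions (paths) $t\mapsto X_t^x$, $[0,\infty[\to\mathbb{R}$, not depending on $\omega$, with $X_0^x=x$ for every $x$, such that: whenever $X_s^x=X_t^y$ for some $s,t\ge 0$ and $x,y\in\mathbb{R}$, then $X_{s+h}^x=X_{t+h}^y$ for every $h\ge 0$. Càdlàg means that all paths are right-continuous with left limits. The process is viewed as a stochastic process on some fixed stochastic basis $(\Omega,\mathcal{F},(\mathcal{F}_t)_{t\ge0},\mathbb{P})$ with $X_t^x(\omega)$ independent of $\omega$; $X$ is called a semimartingale if for every $x\in\mathbb{R}$ the process $X^x$ is a semimartingale. It is a classical fact that a deterministic process is a semimartingale if and only if for every $x$ the path $t\mapsto X_t^x$ is càdlàg and of finite variation on compact intervals. *)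

theory Defs
  imports "HOL-Probability.Probability"
begin

section \<open>Paths\<close>

text \<open>Time is \<open>[0,\<infinity>)\<close>; it is represented by the type \<^typ>\<open>real\<close>, and values at negative times are
  never looked at.\<close>

definition cadlag :: "(real \<Rightarrow> real) \<Rightarrow> bool" where
  "cadlag f \<longleftrightarrow>
     (\<forall>t\<ge>0. (f \<longlongrightarrow> f t) (at_right t)) \<and>
     (\<forall>t>0. \<exists>l. (f \<longlongrightarrow> l) (at_left t))"

definition finite_variation :: "(real \<Rightarrow> real) \<Rightarrow> bool" where
  "finite_variation f \<longleftrightarrow>
     (\<forall>T\<ge>0. bdd_above {\<Sum>i<n. \<bar>f (p (Suc i)) - f (p i)\<bar> | (n::nat) p.
        mono_on {..n} p \<and> p ` {..n} \<subseteq> {0..T}})"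

definition jump :: "(real \<Rightarrow> real) \<Rightarrow> real \<Rightarrow> real" where
  "jump f s = f s - Lim (at_left s) f"

definition locally_summable_jumps :: "(real \<Rightarrow> real) \<Rightarrow> bool" where
  "locally_summable_jumps f \<longleftrightarrow> (\<forall>T>0. (\<lambda>s. \<bar>jump f s\<bar>) summable_on {0<..T})"


section \<open>Semimartingales\<close>

text \<open>Only the \<open>\<sigma>\<close>-algebras \<open>F t\<close> with \<open>t \<ge> 0\<close> are relevant; a filtration indexed by \<open>[0,\<infinity>)\<close> is
  extended to negative times by, e.g., \<open>F 0\<close>. Right-continuity is assumed, completeness is not.\<close>

locale stochastic_basis = prob_space M + filtration "space M" F
  for M :: "'a measure" and F :: "real \<Rightarrow> 'a measure" +
  assumes subalgebra_F: "\<And>t. 0 \<le> t \<Longrightarrow> subalgebra M (F t)"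
    and right_continuous_F: "\<And>t. 0 \<le> t \<Longrightarrow> sets (F t) = (\<Inter>s\<in>{t<..}. sets (F s))"

definition adapted :: "(real \<Rightarrow> 'a measure) \<Rightarrow> (real \<Rightarrow> 'a \<Rightarrow> real) \<Rightarrow> bool" where
  "adapted F X \<longleftrightarrow> (\<forall>t\<ge>0. X t \<in> borel_measurable (F t))"

definition martingale ::
    "'a measure \<Rightarrow> (real \<Rightarrow> 'a measure) \<Rightarrow> (real \<Rightarrow> 'a \<Rightarrow> real) \<Rightarrow> bool" where
  "martingale M F X \<longleftrightarrow>
     adapted F X \<and>
     (AE \<omega> in M. cadlag (\<lambda>t. X t \<omega>)) \<and>
     (\<forall>t\<ge>0. integrable M (X t)) \<and>
     (\<forall>s t. 0 \<le> s \<and> s \<le> t \<longrightarrow> (AE \<omega> in M. real_cond_exp M (F s) (X t) \<omega> = X s \<omega>))"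

text \<open>The library constant \<^const>\<open>stopping_time\<close> forces the values of \<open>T\<close> to lie in the index type
  of the filtration; here \<open>T\<close> takes values in \<open>[0,\<infinity>]\<close>.\<close>

definition ext_stopping_time :: "(real \<Rightarrow> 'a measure) \<Rightarrow> ('a \<Rightarrow> ennreal) \<Rightarrow> bool" where
  "ext_stopping_time F T \<longleftrightarrow> (\<forall>t\<ge>0. Measurable.pred (F t) (\<lambda>\<omega>. T \<omega> \<le> ennreal t))"

definition stopped :: "(real \<Rightarrow> 'a \<Rightarrow> real) \<Rightarrow> ('a \<Rightarrow> ennreal) \<Rightarrow> real \<Rightarrow> 'a \<Rightarrow> real" where
  "stopped X T t \<omega> = X (enn2real (min (ennreal t) (T \<omega>))) \<omega>"

definition local_martingale ::
    "'a measure \<Rightarrow> (real \<Rightarrow> 'a measure) \<Rightarrow> (real \<Rightarrow> 'a \<Rightarrow> real) \<Rightarrow> bool" where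
  "local_martingale M F X \<longleftrightarrow>
     adapted F X \<and>
     (AE \<omega> in M. cadlag (\<lambda>t. X t \<omega>)) \<and>
     (\<exists>T :: nat \<Rightarrow> 'a \<Rightarrow> ennreal.
        (\<forall>n. ext_stopping_time F (T n)) \<and>
        (\<forall>\<omega>\<in>space M. incseq (\<lambda>n. T n \<omega>)) \<and>
        (AE \<omega> in M. (\<lambda>n. T n \<omega>) \<longlonglongrightarrow> \<infinity>) \<and>
        (\<forall>n. martingale M F (stopped X (T n))))"

definition finite_variation_process ::
    "'a measure \<Rightarrow> (real \<Rightarrow> 'a measure) \<Rightarrow> (real \<Rightarrow> 'a \<Rightarrow> real) \<Rightarrow> bool" where
  "finite_variation_process M F A \<longleftrightarrow>
     adapted F A \<and>
     (\<forall>\<omega>\<in>space M. cadlag (\<lambda>t. A t \<omega>) \<and> finite_variation (\<lambda>t. A t \<omega>))"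

definition semimartingale ::
    "'a measure \<Rightarrow> (real \<Rightarrow> 'a measure) \<Rightarrow> (real \<Rightarrow> 'a \<Rightarrow> real) \<Rightarrow> bool" where
  "semimartingale M F X \<longleftrightarrow>
     X 0 \<in> borel_measurable (F 0) \<and>
     (\<exists>L A. local_martingale M F L \<and> finite_variation_process M F A \<and>
        (\<forall>\<omega>\<in>space M. L 0 \<omega> = 0 \<and> A 0 \<omega> = 0) \<and>
        (\<forall>t\<ge>0. \<forall>\<omega>\<in>space M. X t \<omega> = X 0 \<omega> + L t \<omega> + A t \<omega>))"


section \<open>Deterministic Markov processes\<close>

text \<open>\<open>X x t\<close> is the position at time \<open>t\<close> of the path started at \<open>x\<close>.\<close>

definition deterministic_markov_process :: "(real \<Rightarrow> real \<Rightarrow> real) \<Rightarrow> bool" where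
  "deterministic_markov_process X \<longleftrightarrow>
     (\<forall>x. X x 0 = x) \<and>
     (\<forall>x y s t. 0 \<le> s \<and> 0 \<le> t \<and> X x s = X y t \<longrightarrow> (\<forall>h\<ge>0. X x (s + h) = X y (t + h)))"

definition deterministic_semimartingale ::
    "'a measure \<Rightarrow> (real \<Rightarrow> 'a measure) \<Rightarrow> (real \<Rightarrow> real \<Rightarrow> real) \<Rightarrow> bool" where
  "deterministic_semimartingale M F X \<longleftrightarrow> (\<forall>x. semimartingale M F (\<lambda>t \<omega>. X x t))"

end

theory Submission
  imports Defs
begin

text \<open>A deterministic process is a semimartingale iff its paths have finite variation. For the
  nontrivial direction, write the path as a local martingale plus a finite variation process and
  integrate, along a partition, the signs of the increments of the path against the martingale until
  the discrete variation of the second process exceeds \<open>K\<close>: since the transform has mean zero, the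
  variation of the path along the partition is bounded independently of the partition.

  A path of finite variation has summable jumps. Conversely, let the jumps be summable. By the Markov
  property a return of the path to an earlier value makes it periodic, so by right-continuity either
  the path is constant in between or the return takes at least some fixed time \<open>\<delta>\<close>. Hence in bounded
  time each level \<open>y\<close> is crossed without a jump over \<open>y\<close> only boundedly often, and integrating the
  number of crossings over \<open>y\<close> bounds the variation by a constant plus the sum of the jumps.\<close>

section \<open>Jumps and variation of cadlag paths\<close>

lemma cadlag_tendsto_right: "cadlag f \<Longrightarrow> 0 \<le> t \<Longrightarrow> (f \<longlongrightarrow> f t) (at_right t)"
  by (simp add: cadlag_def)

text \<open>Later proofs write the left limit at \<open>t\<close> as \<open>f t - jump f t\<close>,
  so that \<open>Lim\<close> need not be handled again.\<close>

lemma cadlag_tendsto_left: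
  assumes "cadlag f" "0 < t"
  shows "(f \<longlongrightarrow> f t - jump f t) (at_left t)"
proof -
  obtain l where l: "(f \<longlongrightarrow> l) (at_left t)"
    using assms by (auto simp: cadlag_def)
  then have "Lim (at_left t) f = l"
    by (intro tendsto_Lim) auto
  with l show ?thesis
    by (simp add: jump_def)
qed

lemma cadlag_compose_continuous:
  assumes "cadlag f" and g: "\<And>x. isCont g x"
  shows "cadlag (\<lambda>t. g (f t))"
  unfolding cadlag_def
proof (intro conjI allI impI)
  show "((\<lambda>t. g (f t)) \<longlongrightarrow> g (f t)) (at_right t)" if "0 \<le> t" for t
    using that by (intro isCont_tendsto_compose[OF g] cadlag_tendsto_right assms)
  show "\<exists>l. ((\<lambda>t. g (f t)) \<longlongrightarrow> l) (at_left t)" if "0 < t" for t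
    using isCont_tendsto_compose[OF g cadlag_tendsto_left[OF assms(1) that]] by (rule exI)
qed

lemma cadlag_uminus: "cadlag f \<Longrightarrow> cadlag (\<lambda>t. - f t)"
  by (rule cadlag_compose_continuous) (auto intro: continuous_intros)

lemma cadlag_diff_const: "cadlag f \<Longrightarrow> cadlag (\<lambda>t. f t - c)"
  by (rule cadlag_compose_continuous) (auto intro: continuous_intros)

lemma jump_uminus:
  assumes "cadlag f" "0 < t"
  shows "jump (\<lambda>t. - f t) t = - jump f t"
proof -
  have "((\<lambda>t. - f t) \<longlongrightarrow> - (f t - jump f t)) (at_left t)"
    by (intro tendsto_minus cadlag_tendsto_left assms)
  moreover have "((\<lambda>t. - f t) \<longlongrightarrow> - f t - jump (\<lambda>t. - f t) t) (at_left t)"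
    by (intro cadlag_tendsto_left cadlag_uminus assms)
  ultimately have "- (f t - jump f t) = - f t - jump (\<lambda>t. - f t) t"
    by (intro tendsto_unique[of "at_left t"]) auto
  then show ?thesis by simp
qed

section \<open>Boundedness and level crossings of cadlag paths\<close>

text \<open>Compactness in the form of \<open>Bolzano\<close> induction: near a point the path stays
  close to its value there or to its left limit, and bounds on adjacent intervals combine.\<close>

lemma cadlag_bounded:
  assumes "cadlag f" "0 \<le> T"
  obtains C where "0 \<le> C" "\<And>t. t \<in> {0..T} \<Longrightarrow> \<bar>f t\<bar> \<le> C"
proof -
  \<comment> \<open>The small intervals of the local step may reach below \<open>0\<close>, where
    nothing is known about \<open>f\<close>; hence the guard \<open>0 \<le> t\<close>.\<close>
  define P where "P a b \<longleftrightarrow> (\<exists>C. \<forall>t\<in>{a..b}. 0 \<le> t \<longrightarrow> \<bar>f t\<bar> \<le> C)" for a b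
  have "P 0 T"
    using \<open>0 \<le> T\<close>
  proof (induction rule: Bolzano)
    case (trans a b c)
    then obtain C D where "\<forall>t\<in>{a..b}. 0 \<le> t \<longrightarrow> \<bar>f t\<bar> \<le> C"
      "\<forall>t\<in>{b..c}. 0 \<le> t \<longrightarrow> \<bar>f t\<bar> \<le> D"
      unfolding P_def by blast
    then have "\<forall>t\<in>{a..c}. 0 \<le> t \<longrightarrow> \<bar>f t\<bar> \<le> max C D"
      by (auto simp: le_max_iff_disj)
    then show ?case unfolding P_def by blast
  next
    case (local x)
    obtain b where b: "x < b" "\<And>t. t > x \<Longrightarrow> t < b \<Longrightarrow> dist (f t) (f x) < 1"
      using tendstoD[OF cadlag_tendsto_right[OF assms(1) local(1)], of 1]
      unfolding eventually_at_right_field by auto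
    define d1 where "d1 = b - x"
    have d1: "0 < d1" "\<And>t. t \<in> {x<..<x + d1} \<Longrightarrow> dist (f t) (f x) < 1"
      using b by (auto simp: d1_def)
    obtain d2 l where d2: "0 < d2" "\<And>t. t \<in> {x - d2<..<x} \<Longrightarrow> 0 \<le> t \<Longrightarrow> dist (f t) l < 1"
    proof (cases "x = 0")
      case True
      \<comment> \<open>No admissible time lies to the left of \<open>0\<close>, so any
        \<open>d2 > 0\<close> and any \<open>l\<close> serve vacuously.\<close>
      then show thesis by (intro that[of 1 0]) auto
    next
      case False
      with local have "0 < x" by simp
      from tendstoD[OF cadlag_tendsto_left[OF assms(1) this], of 1]
      obtain b where "b < x" "\<And>t. t > b \<Longrightarrow> t < x \<Longrightarrow> dist (f t) (f x - jump f x) < 1"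
        unfolding eventually_at_left_field by auto
      then show thesis by (intro that[of "x - b" "f x - jump f x"]) auto
    qed
    have bound: "\<bar>f t\<bar> \<le> \<bar>f x\<bar> + \<bar>l\<bar> + 1" if "0 \<le> t" "\<bar>t - x\<bar> < min d1 d2" for t
    proof (cases t x rule: linorder_cases)
      case less
      then have "dist (f t) l < 1" using that by (intro d2(2)) auto
      then show ?thesis unfolding dist_real_def by linarith
    next
      case greater
      then have "dist (f t) (f x) < 1" using that by (intro d1(2)) auto
      then show ?thesis unfolding dist_real_def by linarith
    qed simp
    show ?case
    proof (intro exI[of _ "min d1 d2"] conjI allI impI)
      fix a b assume ab: "a \<le> x \<and> x \<le> b \<and> b - a < min d1 d2"
      have "\<bar>f t\<bar> \<le> \<bar>f x\<bar> + \<bar>l\<bar> + 1" if "a \<le> t" "t \<le> b" "0 \<le> t" for t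
        using ab that by (intro bound) linarith+
      then show "P a b"
        unfolding P_def by (intro exI[of _ "\<bar>f x\<bar> + \<bar>l\<bar> + 1"]) simp
    qed (use d1(1) d2(1) in simp)
  qed
  then obtain C where "\<forall>t\<in>{0..T}. \<bar>f t\<bar> \<le> C" unfolding P_def by auto
  then show thesis
    using that[of "max 0 C"] by (simp add: le_max_iff_disj)
qed

text \<open>A substitute for the intermediate value theorem. Take for \<open>s\<close> the first
  time the path is at or above \<open>y\<close>: right-continuity gives \<open>y \<le> f s\<close>,
  and all values on \<open>{p..<s}\<close> are below \<open>y\<close>, so the left limit is at most
  \<open>y\<close>.\<close>

lemma cadlag_crossing_up:
  assumes f: "cadlag f" and "0 \<le> p" "p < q" "f p < y" "y < f q"
  obtains s where "p < s" "s \<le> q" "f s - jump f s \<le> y" "y \<le> f s"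
proof -
  define A where "A = {t \<in> {p..q}. y \<le> f t}"
  define s where "s = Inf A"
  have "q \<in> A" using assms by (auto simp: A_def)
  have lb: "bdd_below A" by (intro bdd_belowI[of _ p]) (auto simp: A_def)
  have "p \<le> s" "s \<le> q"
    using \<open>q \<in> A\<close> lb by (auto simp: s_def A_def intro!: cInf_greatest cInf_lower)
  have below: "f t < y" if "p \<le> t" "t < s" for t
    using that \<open>s \<le> q\<close> cInf_lower[OF _ lb, of t] by (force simp: A_def s_def)
  have "y \<le> f s"
  proof (rule ccontr)
    assume "\<not> y \<le> f s"
    then have "eventually (\<lambda>t. f t < y) (at_right s)"
      using cadlag_tendsto_right[OF f, of s] \<open>0 \<le> p\<close> \<open>p \<le> s\<close>
      by (intro order_tendstoD(2)) auto
    then obtain d where "s < d" and d: "\<And>t. s < t \<Longrightarrow> t < d \<Longrightarrow> f t < y"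
      unfolding eventually_at_right_field by auto
    \<comment> \<open>If \<open>f s < y\<close>, the path stays below \<open>y\<close> on all of
      \<open>{s..<d}\<close>, so \<open>A\<close> has a lower bound larger than its infimum
      \<open>s\<close>.\<close>
    have "d \<le> Inf A"
    proof (rule cInf_greatest)
      fix t assume "t \<in> A"
      moreover from this have "s \<le> t" using lb by (auto simp: s_def intro: cInf_lower)
      ultimately show "d \<le> t"
        using d[of t] \<open>\<not> y \<le> f s\<close> by (cases "t = s") (force simp: A_def)+
    qed (use \<open>q \<in> A\<close> in auto)
    with \<open>s < d\<close> show False by (simp add: s_def)
  qed
  with \<open>f p < y\<close> \<open>p \<le> s\<close> have "p < s" by (cases "p = s") auto
  moreover have "f s - jump f s \<le> y"
  proof (rule tendsto_upperbound)
    show "(f \<longlongrightarrow> f s - jump f s) (at_left s)"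
      using \<open>0 \<le> p\<close> \<open>p < s\<close> by (intro cadlag_tendsto_left f) simp
    show "eventually (\<lambda>t. f t \<le> y) (at_left s)"
      using \<open>p < s\<close> below unfolding eventually_at_left_field by (metis less_imp_le)
  qed auto
  ultimately show thesis using that \<open>s \<le> q\<close> \<open>y \<le> f s\<close> by blast
qed

text \<open>Closed at both ends because a crossing yields only weak inequalities. At a continuity
  point it shrinks to the single value \<open>f s\<close>, so levels attained without a jump are
  covered too.\<close>

definition jump_interval :: "(real \<Rightarrow> real) \<Rightarrow> real \<Rightarrow> real set" where
  "jump_interval f s = {min (f s) (f s - jump f s)..max (f s) (f s - jump f s)}"

lemma cadlag_crossing:
  assumes f: "cadlag f" and p: "0 \<le> p" "p < q"
    and y: "y \<in> {min (f p) (f q)<..<max (f p) (f q)}"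
  obtains s where "p < s" "s \<le> q" "y \<in> jump_interval f s"
proof (cases "f p < f q")
  case True
  then have "f p < y" "y < f q" using y by auto
  from cadlag_crossing_up[OF f p this] obtain s
    where "p < s" "s \<le> q" "f s - jump f s \<le> y" "y \<le> f s" .
  then show thesis
    using that[of s] by (simp add: jump_interval_def)
next
  case False
  then have "- f p < - y" "- y < - f q" using y by auto
  from cadlag_crossing_up[OF cadlag_uminus[OF f] p this] obtain s
    where s: "p < s" "s \<le> q" "- f s - jump (\<lambda>t. - f t) s \<le> - y" "- y \<le> - f s" .
  then show thesis
    using that[of s] jump_uminus[OF f, of s] p by (simp add: jump_interval_def)
qed

section \<open>Finite variation implies summable jumps\<close>

abbreviation partition_sums :: "(real \<Rightarrow> real) \<Rightarrow> real \<Rightarrow> real set" where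
  "partition_sums f T \<equiv> {\<Sum>i<n. \<bar>f (p (Suc i)) - f (p i)\<bar> | (n::nat) p.
     mono_on {..n} p \<and> p ` {..n} \<subseteq> {0..T}}"

lemma partition_sums_extend:
  assumes "0 \<le> s" "s \<le> t" "z \<in> partition_sums f s"
  shows "\<exists>z'\<in>partition_sums f t. z + \<bar>f t - f s\<bar> \<le> z'"
proof -
  obtain n :: nat and p where z: "z = (\<Sum>i<n. \<bar>f (p (Suc i)) - f (p i)\<bar>)"
    and p: "mono_on {..n} p" "p ` {..n} \<subseteq> {0..s}"
    using assms by auto
  \<comment> \<open>Append the points \<open>s\<close> and \<open>t\<close>. The increment from
    \<open>p n\<close> to \<open>s\<close> is only needed to be nonnegative; the one from
    \<open>s\<close> to \<open>t\<close> is the gain.\<close>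
  define p' where "p' i = (if i \<le> n then p i else if i = Suc n then s else t)" for i
  let ?z' = "\<Sum>i<Suc (Suc n). \<bar>f (p' (Suc i)) - f (p' i)\<bar>"
  have "(\<Sum>i<n. \<bar>f (p' (Suc i)) - f (p' i)\<bar>) = z"
    unfolding z by (intro sum.cong) (auto simp: p'_def)
  then have "z + \<bar>f t - f s\<bar> \<le> ?z'"
    by (simp add: p'_def)
  moreover have "?z' \<in> partition_sums f t"
  proof -
    have pn: "p i \<in> {0..s}" if "i \<le> n" for i using p that by auto
    have "mono_on {..Suc (Suc n)} p'"
    proof (rule mono_onI)
      fix i j assume "i \<in> {..Suc (Suc n)}" "j \<in> {..Suc (Suc n)}" "i \<le> j"
      then show "p' i \<le> p' j"
        using mono_onD[OF p(1), of i j] pn[of i] \<open>s \<le> t\<close> by (auto simp: p'_def)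
    qed
    moreover have "p' ` {..Suc (Suc n)} \<subseteq> {0..t}"
      using pn assms by (force simp: p'_def)
    ultimately show ?thesis by blast
  qed
  ultimately show ?thesis by blast
qed

text \<open>The variation function \<open>v\<close> grows by at least
  \<open>\<bar>f t - f s\<bar>\<close> between \<open>s\<close> and \<open>t\<close>. Letting
  \<open>s\<close> increase to a jump time, \<open>v\<close> grows there by at least the size of the
  jump, so any finite set of jumps up to \<open>t\<close> sums to at most
  \<open>v t\<close>.\<close>

lemma finite_variation_imp_summable_jumps:
  assumes f: "cadlag f" and var: "finite_variation f"
  shows "locally_summable_jumps f"
proof -
  define v where "v t = Sup (partition_sums f t)" for t
  have bdd: "bdd_above (partition_sums f t)" if "0 \<le> t" for t
    using var that by (simp add: finite_variation_def)
  \<comment> \<open>The empty sum makes the set nonempty, as \<open>cSup_least\<close> requires, and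
    gives \<open>0 \<le> v t\<close>.\<close>
  have zero: "0 \<in> partition_sums f t" if "0 \<le> t" for t
  proof -
    have "(\<Sum>i<0::nat. \<bar>f ((\<lambda>_. 0) (Suc i)) - f ((\<lambda>_. 0) i)\<bar>) \<in> partition_sums f t"
      using that by (intro CollectI exI conjI refl) (auto simp: mono_on_def)
    then show ?thesis by simp
  qed
  have v_super: "v s + \<bar>f t - f s\<bar> \<le> v t" if "0 \<le> s" "s \<le> t" for s t
  proof -
    have "z \<le> v t - \<bar>f t - f s\<bar>" if z: "z \<in> partition_sums f s" for z
    proof -
      obtain z' where "z' \<in> partition_sums f t" "z + \<bar>f t - f s\<bar> \<le> z'"
        using partition_sums_extend[OF \<open>0 \<le> s\<close> \<open>s \<le> t\<close> z] by blast
      with cSup_upper[OF this(1) bdd] \<open>0 \<le> s\<close> \<open>s \<le> t\<close> show ?thesis by (simp add: v_def)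
    qed
    then have "v s \<le> v t - \<bar>f t - f s\<bar>"
      unfolding v_def using zero[OF \<open>0 \<le> s\<close>] by (intro cSup_least) auto
    then show ?thesis by simp
  qed
  have finite_sum: "(\<Sum>s\<in>G. \<bar>jump f s\<bar>) \<le> v t" if "finite G" "G \<subseteq> {0<..t}" "0 \<le> t" for G t
    using that
  proof (induction G arbitrary: t rule: finite_linorder_max_induct)
    case empty
    then show ?case using cSup_upper[OF zero bdd] by (simp add: v_def)
  next
    case (insert b G)
    \<comment> \<open>For \<open>u\<close> between \<open>m\<close> and the last jump time
      \<open>b\<close>, the induction hypothesis applies at \<open>u\<close> and leaves the
      increment from \<open>u\<close> to \<open>b\<close>; then \<open>u\<close> tends to
      \<open>b\<close>. Including \<open>0\<close> keeps \<open>u\<close> nonnegative and covers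
      empty \<open>G\<close>.\<close>
    define m where "m = Max (insert 0 G)"
    have "0 < b" "b \<le> t" using insert.prems by auto
    have "m < b" using insert \<open>0 < b\<close> by (simp add: m_def)
    have le: "(\<Sum>s\<in>G. \<bar>jump f s\<bar>) + \<bar>f b - f u\<bar> \<le> v b" if "m < u" "u < b" for u
    proof -
      have m: "x \<le> m" if "x \<in> insert 0 G" for x using that insert.hyps by (simp add: m_def)
      have "0 \<le> u" using m[of 0] that by simp
      moreover have "G \<subseteq> {0<..u}" using m that insert.prems by force
      ultimately show ?thesis using insert.IH[of u] v_super[of u b] that by simp
    qed
    have "(\<Sum>s\<in>G. \<bar>jump f s\<bar>) + \<bar>f b - (f b - jump f b)\<bar> \<le> v b"
    proof (rule tendsto_upperbound)
      show "((\<lambda>u. (\<Sum>s\<in>G. \<bar>jump f s\<bar>) + \<bar>f b - f u\<bar>) \<longlongrightarrow>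
          (\<Sum>s\<in>G. \<bar>jump f s\<bar>) + \<bar>f b - (f b - jump f b)\<bar>) (at_left b)"
        using \<open>0 < b\<close> by (intro tendsto_intros cadlag_tendsto_left f)
      show "eventually (\<lambda>u. (\<Sum>s\<in>G. \<bar>jump f s\<bar>) + \<bar>f b - f u\<bar> \<le> v b) (at_left b)"
        using \<open>m < b\<close> le by (force simp: eventually_at_left_field)
    qed auto
    moreover have "v b \<le> v t"
      using v_super[of b t] \<open>0 < b\<close> \<open>b \<le> t\<close> by simp
    moreover have "b \<notin> G" using insert.hyps by auto
    ultimately show ?case using insert.hyps by simp
  qed
  show ?thesis
    unfolding locally_summable_jumps_def
  proof (intro allI impI nonneg_bdd_above_summable_on)
    fix T :: real assume "0 < T"
    show "bdd_above (sum (\<lambda>s. \<bar>jump f s\<bar>) ` {G. G \<subseteq> {0<..T} \<and> finite G})"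
      using finite_sum \<open>0 < T\<close> by (intro bdd_aboveI2[of _ _ "v T"]) auto
  qed auto
qed

section \<open>Level crossings of Markov paths\<close>

lemma periodic_iterate:
  fixes f :: "real \<Rightarrow> 'b"
  assumes "\<And>t. u \<le> t \<Longrightarrow> f (t + q) = f t" "0 \<le> q" "u \<le> t"
  shows "f (t + real k * q) = f t"
proof (induction k)
  case (Suc k)
  have "f (t + real k * q + q) = f (t + real k * q)"
    using assms by (intro assms(1)) (simp add: add_increasing2)
  then show ?case using Suc by (simp add: algebra_simps)
qed simp

text \<open>Otherwise there are arbitrarily short returns that leave the level in between. By the
  Markov property a return from \<open>u\<close> to \<open>v\<close> makes \<open>v - u\<close> a
  period from \<open>u\<close> on. Fixing one such \<open>u\<close>, the others supply arbitrarily
  small periods; right-continuity then forces the path to be constant after \<open>u\<close>,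
  although it left \<open>f u\<close> at \<open>w\<close>.\<close>

lemma markov_short_return_imp_constant:
  assumes X: "deterministic_markov_process X" and f: "cadlag (X x)"
  shows "\<exists>\<delta>>0. \<forall>u w v. 0 \<le> u \<and> u < w \<and> w < v \<and> v - u < \<delta> \<and> X x u = X x v \<longrightarrow> X x w = X x u"
proof (rule ccontr)
  assume no: "\<not> ?thesis"
  define f where "f = X x"
  have cad: "cadlag f" using f by (simp add: f_def)
  have shift: "f (u + h) = f (v + h)" if "0 \<le> u" "0 \<le> v" "0 \<le> h" "f u = f v" for u v h
    using X that unfolding deterministic_markov_process_def f_def by blast
  have ex: "\<exists>u w v. 0 \<le> u \<and> u < w \<and> w < v \<and> v - u < \<delta> \<and> f u = f v \<and> f w \<noteq> f u"
    if "0 < \<delta>" for \<delta>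
  proof (rule ccontr)
    assume "\<not> ?thesis"
    then show False
      using no that unfolding f_def by blast
  qed
  obtain u w v where uwv: "0 \<le> u" "u < w" "w < v" "f u = f v" "f w \<noteq> f u"
    using ex[of 1] by auto
  define d where "d = v - u"
  have "0 < d" using uwv by (simp add: d_def)
  have d: "f (t + d) = f t" if "u \<le> t" for t
    using shift[of u v "t - u"] uwv that by (simp add: d_def algebra_simps)
  \<comment> \<open>Since the path is \<open>d\<close>-periodic after \<open>u\<close>, any later period is a period from \<open>u\<close> on.\<close>
  have small_period: "\<exists>q. 0 < q \<and> q < \<epsilon> \<and> (\<forall>t\<ge>u. f (t + q) = f t)" if "0 < \<epsilon>" for \<epsilon>
  proof -
    obtain u' v' where u'v': "0 \<le> u'" "u' < v'" "v' - u' < \<epsilon>" "f u' = f v'"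
      using ex[OF \<open>0 < \<epsilon>\<close>] by (meson less_trans)
    have "f (t + (v' - u')) = f t" if "u \<le> t" for t
    proof -
      obtain k :: nat where k: "u' < real k * d"
        using reals_Archimedean3[OF \<open>0 < d\<close>] by blast
      have "f (t + (v' - u')) = f (t + (v' - u') + real k * d)"
        using u'v' that d \<open>0 < d\<close> by (intro periodic_iterate[symmetric, of u]) auto
      also have "\<dots> = f (t + real k * d)"
        using shift[of u' v' "t + real k * d - u'"] u'v' k that uwv by (simp add: algebra_simps)
      also have "\<dots> = f t"
        using that d \<open>0 < d\<close> by (intro periodic_iterate[of u]) auto
      finally show ?thesis .
    qed
    then show ?thesis using u'v' by (intro exI[of _ "v' - u'"]) auto
  qed
  have const_after: "f t = f u" if "u \<le> t" for t
  proof (rule ccontr)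
    assume neq: "f t \<noteq> f u"
    have "eventually (\<lambda>s. f s \<noteq> f u) (at_right t)"
      using that uwv by (intro tendsto_imp_eventually_ne[OF cadlag_tendsto_right[OF cad] neq]) simp
    then obtain b where b: "t < b" "\<And>s. t < s \<Longrightarrow> s < b \<Longrightarrow> f s \<noteq> f u"
      unfolding eventually_at_right_field by auto
    obtain q where q: "0 < q" "q < b - t" "\<And>t. u \<le> t \<Longrightarrow> f (t + q) = f t"
      using small_period[of "b - t"] b by auto
    \<comment> \<open>The first multiple of \<open>q\<close> that carries \<open>u\<close> beyond
      \<open>t\<close>. It overshoots by at most \<open>q < b - t\<close>, so it lands in the window
      where the value \<open>f u\<close> is excluded.\<close>
    define k where "k = nat \<lfloor>(t - u) / q\<rfloor> + 1"
    have k: "real k = of_int \<lfloor>(t - u) / q\<rfloor> + 1"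
      using that q by (simp add: k_def)
    have "(t - u) / q < real k" "real k \<le> (t - u) / q + 1"
      unfolding k by linarith+
    then have "t < u + real k * q" "u + real k * q \<le> t + q"
      using q by (simp_all add: field_simps)
    moreover have "f (u + real k * q) = f u"
      using q by (intro periodic_iterate[of u]) auto
    ultimately show False using b(2)[of "u + real k * q"] q by simp
  qed
  from const_after[of w] uwv(2,5) show False by simp
qed

section \<open>Crossing counts and the variation of paths with summable jumps\<close>

text \<open>Prepares for Tonelli: discarding the times without a jump leaves a countable index set,
  so that its counting measure is \<sigma>-finite.\<close>

lemma summable_jumps_nn_integral_finite:
  assumes "locally_summable_jumps f" "0 \<le> T"
  defines "J \<equiv> {s \<in> {0<..T}. jump f s \<noteq> 0}"
  shows "countable J" "(\<integral>\<^sup>+s. ennreal \<bar>jump f s\<bar> \<partial>count_space J) < \<infinity>"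
proof -
  have "(\<lambda>s. \<bar>jump f s\<bar>) summable_on {0<..T}"
    using assms(1,2) by (cases "T = 0") (auto simp: locally_summable_jumps_def)
  then have summ: "(\<lambda>s. \<bar>jump f s\<bar>) summable_on J"
    by (rule summable_on_subset_banach) (auto simp: J_def)
  then have "integrable (count_space J) (jump f)"
    unfolding abs_summable_on_def[symmetric] abs_summable_equivalent[symmetric] real_norm_def .
  then show "(\<integral>\<^sup>+s. ennreal \<bar>jump f s\<bar> \<partial>count_space J) < \<infinity>"
    by (simp add: integrable_iff_bounded)
  have "countable {s \<in> J. \<bar>jump f s\<bar> \<noteq> 0}"
    using summ by (rule summable_countable_real)
  then show "countable J" by (simp add: J_def)
qed

text \<open>Pigeonhole: each cell of length \<open>\<delta>\<close> contains at most one of the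
  points, and \<open>nat \<lfloor>T / \<delta>\<rfloor> + 1\<close> cells cover
  \<open>{0..T}\<close>.\<close>

lemma strictly_separated_imp_card_le:
  fixes s :: "nat \<Rightarrow> real"
  assumes "finite B" "0 < \<delta>" and range: "\<And>i. i \<in> B \<Longrightarrow> s i \<in> {0..T}"
    and sep: "\<And>i j. i \<in> B \<Longrightarrow> j \<in> B \<Longrightarrow> i < j \<Longrightarrow> \<delta> \<le> s j - s i"
  shows "card B \<le> nat \<lfloor>T / \<delta>\<rfloor> + 1"
proof -
  have less: "nat \<lfloor>s i / \<delta>\<rfloor> < nat \<lfloor>s j / \<delta>\<rfloor>" if "i \<in> B" "j \<in> B" "i < j" for i j
  proof -
    have "s i / \<delta> + 1 \<le> s j / \<delta>"
      using sep[OF that] divide_right_mono[of "s i + \<delta>" "s j" \<delta>] \<open>0 < \<delta>\<close>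
      by (simp add: add_divide_distrib)
    then have "\<lfloor>s i / \<delta>\<rfloor> < \<lfloor>s j / \<delta>\<rfloor>" by linarith
    moreover have "0 \<le> \<lfloor>s i / \<delta>\<rfloor>" using range[of i] that \<open>0 < \<delta>\<close> by simp
    ultimately show ?thesis by linarith
  qed
  then have "inj_on (\<lambda>i. nat \<lfloor>s i / \<delta>\<rfloor>) B"
    by (intro inj_onI) (metis nat_neq_iff)
  moreover have "(\<lambda>i. nat \<lfloor>s i / \<delta>\<rfloor>) ` B \<subseteq> {..nat \<lfloor>T / \<delta>\<rfloor>}"
    using range \<open>0 < \<delta>\<close> by (auto intro!: nat_mono floor_mono divide_right_mono)
  ultimately have "card B \<le> card {..nat \<lfloor>T / \<delta>\<rfloor>}"
    by (intro card_inj_on_le) auto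
  then show ?thesis by simp
qed

text \<open>Crossings of a level \<open>y\<close> without a jump over \<open>y\<close> attain \<open>y\<close>, so they are separated in time
  by \<open>\<delta>\<close>; all the others are charged to a jump over \<open>y\<close>. Integrating this count over \<open>y\<close> bounds
  the variation.\<close>

lemma card_crossings_le:
  fixes n :: nat
  assumes f: "cadlag f" and "0 < \<delta>"
    and ret: "\<And>u w v. \<lbrakk>0 \<le> u; u < w; w < v; v - u < \<delta>; f u = f v\<rbrakk> \<Longrightarrow> f w = f u"
    and p: "mono_on {..n} p" "p ` {..n} \<subseteq> {0..T}"
  defines "J \<equiv> {s \<in> {0<..T}. jump f s \<noteq> 0}"
  shows "of_nat (card {i. i < n \<and> y \<in> {min (f (p i)) (f (p (Suc i)))<..<max (f (p i)) (f (p (Suc i)))}})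
    \<le> of_nat (nat \<lfloor>T / \<delta>\<rfloor> + 1) + emeasure (count_space J) {s \<in> J. y \<in> jump_interval f s}"
proof -
  define D where "D i = {min (f (p i)) (f (p (Suc i)))<..<max (f (p i)) (f (p (Suc i)))}" for i
  define A where "A = {i. i < n \<and> y \<in> D i}"
  define S where "S = {s \<in> J. y \<in> jump_interval f s}"
  have mono: "p i \<le> p j" if "i \<le> j" "j \<le> n" for i j
    by (rule mono_onD[OF p(1)]) (use that in auto)
  have range: "p i \<in> {0..T}" if "i \<le> n" for i
    using p(2) that by auto
  have "\<exists>s. p i < s \<and> s \<le> p (Suc i) \<and> y \<in> jump_interval f s" if "i \<in> A" for i
  proof -
    have "y \<in> D i" "i < n" using that by (auto simp: A_def)
    then have "p i \<noteq> p (Suc i)" by (auto simp: D_def)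
    with mono[of i "Suc i"] \<open>i < n\<close> have "p i < p (Suc i)" by simp
    with cadlag_crossing[OF f _ this, of y] range[of i] \<open>i < n\<close> \<open>y \<in> D i\<close> show ?thesis
      unfolding D_def by (metis atLeastAtMost_iff less_imp_le)
  qed
  then obtain s where s: "\<And>i. i \<in> A \<Longrightarrow> p i < s i \<and> s i \<le> p (Suc i) \<and> y \<in> jump_interval f (s i)"
    by metis
  have sT: "s i \<in> {0<..T}" if "i \<in> A" for i
    using s[OF that] range[of i] range[of "Suc i"] that by (auto simp: A_def)
  have s_less: "s i \<le> p (Suc i)" "p (Suc i) < s j" if "i \<in> A" "j \<in> A" "i < j" for i j
    using s[OF that(1)] s[OF that(2)] mono[of "Suc i" j] that by (auto simp: A_def)
  define B where "B = {i \<in> A. jump f (s i) = 0}"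
  have "finite A" by (simp add: A_def)
  have "card B \<le> nat \<lfloor>T / \<delta>\<rfloor> + 1"
  proof (rule strictly_separated_imp_card_le[where s = s])
    show "finite B" using \<open>finite A\<close> by (simp add: B_def)
    show "s i \<in> {0..T}" if "i \<in> B" for i
      using sT[of i] that by (auto simp: B_def)
    fix i j assume ij: "i \<in> B" "j \<in> B" "i < j"
    have y: "f (s i) = y" "f (s j) = y"
      using s[of i] s[of j] ij by (auto simp: B_def jump_interval_def)
    \<comment> \<open>The interval \<open>D i\<close> is open, so the path is off \<open>y\<close>
      at the partition point \<open>p (Suc i)\<close> between \<open>s i\<close> and
      \<open>s j\<close>. The return to \<open>y\<close> is therefore not constant and must take at
      least \<open>\<delta>\<close>.\<close>
    have "f (p (Suc i)) \<noteq> y"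
      using ij by (auto simp: B_def A_def D_def)
    then have "s i < p (Suc i)" "p (Suc i) < s j"
      using s_less[of i j] ij y by (auto simp: B_def order_le_less)
    with ret[of "s i" "p (Suc i)" "s j"] \<open>f (p (Suc i)) \<noteq> y\<close> y sT[of i] ij
    show "\<delta> \<le> s j - s i" by (force simp: B_def)
  qed fact
  \<comment> \<open>Infinitely many jumps may meet the level \<open>y\<close>, hence
    \<open>emeasure\<close> instead of \<open>card\<close>. Distinct crossings get distinct jump
    times because the intervals \<open>{p i<..p (Suc i)}\<close> are disjoint.\<close>
  moreover have "of_nat (card (A - B)) \<le> emeasure (count_space J) S"
  proof -
    have "inj_on s (A - B)"
      using s_less by (intro linorder_inj_onI') force
    then have "card (A - B) = card (s ` (A - B))" by (simp add: card_image)
    also have "of_nat (card (s ` (A - B))) = emeasure (count_space J) (s ` (A - B))"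
      using \<open>finite A\<close> sT by (intro emeasure_count_space_finite[symmetric]) (auto simp: J_def B_def)
    also have "\<dots> \<le> emeasure (count_space J) S"
      using s sT by (intro emeasure_mono) (auto simp: S_def J_def B_def)
    finally show ?thesis .
  qed
  ultimately have "of_nat (card B) + of_nat (card (A - B))
      \<le> of_nat (nat \<lfloor>T / \<delta>\<rfloor> + 1) + emeasure (count_space J) S"
    by (intro add_mono of_nat_mono)
  moreover have "card A = card B + card (A - B)"
    using \<open>finite A\<close> card_mono[of A B] by (simp add: B_def card_Diff_subset)
  ultimately have "of_nat (card A) \<le> of_nat (nat \<lfloor>T / \<delta>\<rfloor> + 1) + emeasure (count_space J) S"
    by (simp only: of_nat_add)
  then show ?thesis by (simp add: A_def D_def S_def)
qed

text \<open>In the spirit of the Banach indicatrix: an increment is the length of the set of levels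
  it crosses, so the sum of increments is the integral over \<open>y\<close> of the crossing count.
  By Tonelli the part of the count due to jumps integrates to the total jump size.\<close>

lemma finite_variation_if_separated_returns:
  assumes f: "cadlag f" "locally_summable_jumps f" and "0 < \<delta>"
    and ret: "\<And>u w v. \<lbrakk>0 \<le> u; u < w; w < v; v - u < \<delta>; f u = f v\<rbrakk> \<Longrightarrow> f w = f u"
  shows "finite_variation f"
  unfolding finite_variation_def
proof (intro allI impI)
  fix T :: real assume "0 \<le> T"
  define J where "J = {s \<in> {0<..T}. jump f s \<noteq> 0}"
  have J: "countable J" "(\<integral>\<^sup>+s. ennreal \<bar>jump f s\<bar> \<partial>count_space J) < \<infinity>"
    using summable_jumps_nn_integral_finite[OF f(2) \<open>0 \<le> T\<close>] by (simp_all add: J_def)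
  obtain C where C: "0 \<le> C" "\<And>t. t \<in> {0..T} \<Longrightarrow> \<bar>f t\<bar> \<le> C"
    using cadlag_bounded[OF f(1) \<open>0 \<le> T\<close>] by blast
  define K where "K = nat \<lfloor>T / \<delta>\<rfloor> + 1"
  \<comment> \<open>Per level at most \<open>K\<close> crossings happen without a jump, and only
    levels in \<open>{-C..C}\<close>, of length \<open>2 * C\<close>, can be crossed.
    \<open>R\<close> does not depend on the partition.\<close>
  define R where "R = ennreal (real K * (2 * C)) + (\<integral>\<^sup>+s. ennreal \<bar>jump f s\<bar> \<partial>count_space J)"
  have "R < \<infinity>" using J(2) by (simp add: R_def)
  have bound: "ennreal (\<Sum>i<n. \<bar>f (p (Suc i)) - f (p i)\<bar>) \<le> R"
    if p: "mono_on {..n} p" "p ` {..n} \<subseteq> {0..T}" for n :: nat and p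
  proof -
    define D where "D i = {min (f (p i)) (f (p (Suc i)))<..<max (f (p i)) (f (p (Suc i)))}" for i
    have D_sub: "D i \<subseteq> {-C..C}" if "i < n" for i
    proof -
      have "p i \<in> {0..T}" "p (Suc i) \<in> {0..T}"
        using subsetD[OF p(2) imageI] that by simp_all
      from C(2)[OF this(1)] C(2)[OF this(2)] show ?thesis by (auto simp: D_def)
    qed
    have pointwise: "(\<Sum>i<n. indicator (D i) y) \<le> of_nat K * indicator {-C..C} y
        + (\<integral>\<^sup>+s. indicator (jump_interval f s) y \<partial>count_space J)" (is "?lhs \<le> (?rhs :: ennreal)") for y
    proof (cases "y \<in> {-C..C}")
      case True
      have "?lhs = of_nat (card {i. i < n \<and> y \<in> D i})"
        by (simp add: indicator_def of_bool_def sum.If_cases Int_def)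
      also have "\<dots> \<le> of_nat K + emeasure (count_space J) {s \<in> J. y \<in> jump_interval f s}"
        unfolding D_def K_def J_def by (rule card_crossings_le[OF f(1) \<open>0 < \<delta>\<close> ret p])
      also have "emeasure (count_space J) {s \<in> J. y \<in> jump_interval f s} =
          (\<integral>\<^sup>+s. indicator {s \<in> J. y \<in> jump_interval f s} s \<partial>count_space J)"
        by (intro nn_integral_indicator[symmetric]) auto
      also have "\<dots> = (\<integral>\<^sup>+s. indicator (jump_interval f s) y \<partial>count_space J)"
        by (intro nn_integral_cong) (auto simp: indicator_def)
      finally show ?thesis using True by simp
    next
      case False
      then have "y \<notin> D i" if "i < n" for i using D_sub that by blast
      then have "?lhs = 0" by (simp add: indicator_def)
      then show ?thesis by simp
    qed
    have "emeasure lborel (D i) = ennreal \<bar>f (p (Suc i)) - f (p i)\<bar>" for i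
      by (auto simp: D_def min_def max_def abs_real_def)
    then have "ennreal (\<Sum>i<n. \<bar>f (p (Suc i)) - f (p i)\<bar>) = (\<Sum>i<n. emeasure lborel (D i))"
      by simp
    also have "\<dots> = (\<integral>\<^sup>+y. (\<Sum>i<n. indicator (D i) y) \<partial>lborel)"
      by (subst nn_integral_sum) (auto simp: D_def)
    also have "\<dots> \<le> (\<integral>\<^sup>+y. of_nat K * indicator {-C..C} y
        + (\<integral>\<^sup>+s. indicator (jump_interval f s) y \<partial>count_space J) \<partial>lborel)"
      by (intro nn_integral_mono pointwise)
    also have "\<dots> = (\<integral>\<^sup>+y. of_nat K * indicator {-C..C} y \<partial>lborel)
        + (\<integral>\<^sup>+y. (\<integral>\<^sup>+s. indicator (jump_interval f s) y \<partial>count_space J) \<partial>lborel)"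
    proof (rule nn_integral_add)
      interpret sigma_finite_measure "count_space J"
        using J(1) by (rule sigma_finite_measure_count_space_countable)
      \<comment> \<open>Since \<open>J\<close> is countable, joint measurability reduces to
        measurability in the level for each fixed jump time.\<close>
      have "(\<lambda>(s, y). indicator (jump_interval f s) y) \<in> borel_measurable (count_space J \<Otimes>\<^sub>M lborel)"
        using J(1) by (rule measurable_pair_measure_countable1) (auto simp: jump_interval_def)
      then have "(\<lambda>(y, s). indicator (jump_interval f s) y) \<in> borel_measurable (lborel \<Otimes>\<^sub>M count_space J)"
        by (subst measurable_pair_swap_iff) simp
      then show "(\<lambda>y. \<integral>\<^sup>+s. indicator (jump_interval f s) y \<partial>count_space J) \<in> borel_measurable lborel"
        by (rule borel_measurable_nn_integral)
    qed simp
    also have "(\<integral>\<^sup>+y. of_nat K * indicator {-C..C} y \<partial>lborel) = ennreal (real K * (2 * C))"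
      using C(1) by (subst nn_integral_cmult_indicator) (auto simp: ennreal_mult ennreal_of_nat_eq_real_of_nat)
    also have "(\<integral>\<^sup>+y. (\<integral>\<^sup>+s. indicator (jump_interval f s) y \<partial>count_space J) \<partial>lborel) =
        (\<integral>\<^sup>+s. (\<integral>\<^sup>+y. indicator (jump_interval f s) y \<partial>lborel) \<partial>count_space J)"
      using J(1) by (intro nn_integral_count_space_nn_integral) (auto simp: jump_interval_def)
    also have "\<dots> = (\<integral>\<^sup>+s. ennreal \<bar>jump f s\<bar> \<partial>count_space J)"
      by (intro nn_integral_cong) (auto simp: jump_interval_def min_def max_def)
    finally show ?thesis by (simp add: R_def)
  qed
  have "z \<le> enn2real R" if "z \<in> partition_sums f T" for z
  proof -
    from that have "0 \<le> z" "ennreal z \<le> R" by (auto intro: sum_nonneg simp: bound)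
    then show ?thesis
      using enn2real_mono[of "ennreal z" R] \<open>R < \<infinity>\<close> by simp
  qed
  then show "bdd_above (partition_sums f T)"
    by (rule bdd_aboveI)
qed

lemma markov_summable_jumps_imp_finite_variation:
  assumes "deterministic_markov_process X" "cadlag (X x)" "locally_summable_jumps (X x)"
  shows "finite_variation (X x)"
proof -
  from markov_short_return_imp_constant[of X x, OF assms(1,2)] obtain \<delta> where "0 < \<delta>"
    and "\<forall>u w v. 0 \<le> u \<and> u < w \<and> w < v \<and> v - u < \<delta> \<and> X x u = X x v \<longrightarrow> X x w = X x u"
    by auto
  then show ?thesis
    by (intro finite_variation_if_separated_returns[OF assms(2,3), of \<delta>]) blast+
qed

section \<open>Deterministic semimartingales\<close>

lemma martingale_set_integral:
  assumes basis: "stochastic_basis M F" and Y: "martingale M F Y"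
    and st: "0 \<le> s" "s \<le> t" and B: "B \<in> sets (F s)"
  shows "(\<integral>\<omega>. indicator B \<omega> * Y s \<omega> \<partial>M) = (\<integral>\<omega>. indicator B \<omega> * Y t \<omega> \<partial>M)"
proof -
  interpret stochastic_basis M F by fact
  interpret finite_measure_subalgebra M "F s"
    using subalgebra_F[OF \<open>0 \<le> s\<close>] by unfold_locales
  have int: "integrable M (Y s)" "integrable M (Y t)"
    using Y st by (auto simp: martingale_def)
  have "B \<in> sets M" using subalg B by (auto simp: subalgebra_def)
  have ae: "AE \<omega> in M. real_cond_exp M (F s) (Y t) \<omega> = Y s \<omega>"
    using Y st by (auto simp: martingale_def)
  have "(\<integral>\<omega>. indicator B \<omega> * Y t \<omega> \<partial>M) = (\<integral>\<omega>. indicator B \<omega> * real_cond_exp M (F s) (Y t) \<omega> \<partial>M)"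
    using real_cond_exp_intA[OF int(2) B] by (simp add: set_lebesgue_integral_def)
  also have "\<dots> = (\<integral>\<omega>. indicator B \<omega> * Y s \<omega> \<partial>M)"
    using ae \<open>B \<in> sets M\<close> int by (intro integral_cong_AE) auto
  finally show ?thesis ..
qed

text \<open>The submartingale property of \<open>\<bar>Y\<bar>\<close>, without Jensen: split
  \<open>B\<close> by the sign of \<open>Y s\<close> into two events known at time \<open>s\<close>
  and use the martingale equality on each.\<close>

lemma martingale_set_integral_abs_le:
  assumes basis: "stochastic_basis M F" and Y: "martingale M F Y"
    and st: "0 \<le> s" "s \<le> t" and B: "B \<in> sets (F s)"
  shows "(\<integral>\<omega>. indicator B \<omega> * \<bar>Y s \<omega>\<bar> \<partial>M) \<le> (\<integral>\<omega>. indicator B \<omega> * \<bar>Y t \<omega>\<bar> \<partial>M)"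
proof -
  interpret stochastic_basis M F by fact
  have int: "integrable M (Y s)" "integrable M (Y t)"
    using Y st by (auto simp: martingale_def)
  have sub: "space (F s) = space M" "sets (F s) \<subseteq> sets M"
    using subalgebra_F[OF \<open>0 \<le> s\<close>] by (auto simp: subalgebra_def)
  have Ys: "Y s \<in> borel_measurable (F s)"
    using Y st by (auto simp: martingale_def adapted_def)
  have int_ind: "integrable M (\<lambda>\<omega>. indicator A \<omega> * h \<omega>)"
    if "A \<in> sets (F s)" "integrable M h" for A and h :: "'a \<Rightarrow> real"
    using integrable_mult_indicator[of A M h] that sub by auto
  define P where "P = B \<inter> {\<omega> \<in> space (F s). 0 \<le> Y s \<omega>}"
  define N where "N = B \<inter> {\<omega> \<in> space (F s). Y s \<omega> < 0}"
  have PN: "P \<in> sets (F s)" "N \<in> sets (F s)"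
    unfolding P_def N_def using B Ys by measurable
  have BM: "B \<subseteq> space M" using sets.sets_into_space[OF B] sub by simp
  have "(\<integral>\<omega>. indicator B \<omega> * \<bar>Y s \<omega>\<bar> \<partial>M) = (\<integral>\<omega>. indicator P \<omega> * Y s \<omega> - indicator N \<omega> * Y s \<omega> \<partial>M)"
    using BM sub by (intro Bochner_Integration.integral_cong) (auto simp: P_def N_def indicator_def)
  also have "\<dots> = (\<integral>\<omega>. indicator P \<omega> * Y s \<omega> \<partial>M) - (\<integral>\<omega>. indicator N \<omega> * Y s \<omega> \<partial>M)"
    using PN int by (intro Bochner_Integration.integral_diff int_ind)
  also have "\<dots> = (\<integral>\<omega>. indicator P \<omega> * Y t \<omega> \<partial>M) - (\<integral>\<omega>. indicator N \<omega> * Y t \<omega> \<partial>M)"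
    using martingale_set_integral[OF basis Y st] PN by simp
  also have "\<dots> = (\<integral>\<omega>. indicator P \<omega> * Y t \<omega> - indicator N \<omega> * Y t \<omega> \<partial>M)"
    using PN int by (intro Bochner_Integration.integral_diff[symmetric] int_ind)
  also have "\<dots> \<le> (\<integral>\<omega>. indicator B \<omega> * \<bar>Y t \<omega>\<bar> \<partial>M)"
    using PN B int by (intro integral_mono Bochner_Integration.integrable_diff int_ind integrable_abs)
      (auto simp: P_def N_def indicator_def)
  finally show ?thesis .
qed

text \<open>\<open>H\<close> records that neither the localising time nor the bound \<open>K\<close> on the variation of \<open>a\<close> has been
  exceeded so far. The martingale transform on the right has mean zero, and the last sum is the size
  of \<open>m\<close> just after leaving \<open>H\<close>.\<close>

lemma transform_lower_bound:
  fixes g m a :: "nat \<Rightarrow> real" and H :: "nat \<Rightarrow> bool"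
  assumes H: "\<And>i. i < n \<Longrightarrow> H (Suc i) \<Longrightarrow> H i"
    and g: "\<And>i. i \<le> n \<Longrightarrow> H i \<Longrightarrow> g i = m i + a i"
    and C: "\<And>i. i \<le> n \<Longrightarrow> \<bar>g i\<bar> \<le> C"
    and K: "\<And>i. i \<le> n \<Longrightarrow> H i \<Longrightarrow> \<bar>a 0\<bar> + (\<Sum>j<i. \<bar>a (Suc j) - a j\<bar>) \<le> K"
    and "0 \<le> K"
  shows "of_bool (H n) * (\<Sum>i<n. \<bar>g (Suc i) - g i\<bar>) - (2 * K + C)
    \<le> (\<Sum>i<n. of_bool (H i) * (sgn (g (Suc i) - g i) * (m (Suc i) - m i)))
      + (\<Sum>i<n. of_bool (H i \<and> \<not> H (Suc i)) * \<bar>m (Suc i)\<bar>)"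
proof -
  \<comment> \<open>With \<open>\<bar>a 0\<bar>\<close> included, \<open>V i\<close> dominates
    \<open>\<bar>a i\<bar>\<close> too, so that \<open>m = g - a\<close> is bounded by
    \<open>C + K\<close> inside \<open>H\<close>.\<close>
  define V where "V i = \<bar>a 0\<bar> + (\<Sum>j<i. \<bar>a (Suc j) - a j\<bar>)" for i
  define R where "R k = (\<Sum>i<k. of_bool (H i) * (sgn (g (Suc i) - g i) * (m (Suc i) - m i)))
      + (\<Sum>i<k. of_bool (H i \<and> \<not> H (Suc i)) * \<bar>m (Suc i)\<bar>)" for k
  have aV: "\<bar>a i\<bar> \<le> V i" for i
    by (induction i) (auto simp: V_def)
  have "0 \<le> C" using C[of 0] by simp
  \<comment> \<open>Inside \<open>H\<close> the transform gains the increments of \<open>g\<close>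
    at the cost of those of \<open>a\<close>. On leaving, \<open>R k\<close> is at least
    \<open>- K\<close>, and of the last increment \<open>\<bar>m (Suc k)\<bar>\<close> is paid by
    the second sum while \<open>\<bar>m k\<bar>\<close> costs at most \<open>C + K\<close>; this is
    the constant \<open>2 * K + C\<close>. Afterwards \<open>R\<close> stays unchanged.\<close>
  have "(H k \<longrightarrow> (\<Sum>i<k. \<bar>g (Suc i) - g i\<bar>) - V k \<le> R k) \<and> (\<not> H k \<longrightarrow> - (2 * K + C) \<le> R k)"
    if "k \<le> n" for k
    using that
  proof (induction k)
    case 0
    then show ?case using \<open>0 \<le> K\<close> \<open>0 \<le> C\<close> by (simp add: R_def V_def)
  next
    case (Suc k)
    define \<sigma> where "\<sigma> = sgn (g (Suc k) - g k)"
    have \<sigma>: "\<bar>\<sigma> * x\<bar> \<le> \<bar>x\<bar>" for x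
      by (simp add: \<sigma>_def abs_mult sgn_if)
    have R: "R (Suc k) = R k + of_bool (H k) * (\<sigma> * (m (Suc k) - m k))
        + of_bool (H k \<and> \<not> H (Suc k)) * \<bar>m (Suc k)\<bar>"
      by (simp add: R_def \<sigma>_def)
    consider "H (Suc k)" "H k" | "\<not> H (Suc k)" "H k" | "\<not> H (Suc k)" "\<not> H k"
      using H[of k] Suc.prems by auto
    then show ?case
    proof cases
      case 1
      have "m (Suc k) - m k = (g (Suc k) - g k) - (a (Suc k) - a k)"
        using g[of k] g[of "Suc k"] 1 Suc.prems by simp
      then have "\<sigma> * (m (Suc k) - m k) = \<sigma> * (g (Suc k) - g k) - \<sigma> * (a (Suc k) - a k)"
        by (simp add: right_diff_distrib)
      also have "\<sigma> * (g (Suc k) - g k) = \<bar>g (Suc k) - g k\<bar>"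
        by (simp add: \<sigma>_def abs_sgn mult.commute)
      finally show ?thesis
        using 1 R Suc \<sigma>[of "a (Suc k) - a k"] by (simp add: V_def)
    next
      case 2
      have "\<bar>m k\<bar> \<le> C + K" "V k \<le> K"
        using g[of k] C[of k] K[of k] aV[of k] 2 Suc.prems by (auto simp: V_def)
      moreover have "- V k \<le> R k"
      proof -
        have "0 \<le> (\<Sum>i<k. \<bar>g (Suc i) - g i\<bar>)" by (intro sum_nonneg) simp
        moreover have "(\<Sum>i<k. \<bar>g (Suc i) - g i\<bar>) - V k \<le> R k" using 2 Suc by simp
        ultimately show ?thesis by linarith
      qed
      ultimately have "- (2 * K + C) \<le> R (Suc k)"
        using 2 R \<sigma>[of "m (Suc k) - m k"] abs_triangle_ineq4[of "m (Suc k)" "m k"]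
        by (simp add: abs_le_iff[of "\<sigma> * _"])
      then show ?thesis using 2 by simp
    next
      case 3
      then show ?thesis using R Suc by simp
    qed
  qed
  from this[of n] show ?thesis
    using K[of n] \<open>0 \<le> K\<close> \<open>0 \<le> C\<close> by (cases "H n") (auto simp: R_def V_def)
qed

text \<open>Because \<open>g\<close> is deterministic, the sign of its next increment is a constant
  and hence a legitimate integrand already at time \<open>p i\<close>. Taking expectations in
  \<open>transform_lower_bound\<close> removes the transform; the exit events are disjoint, so the
  exit terms together cost at most the mean of \<open>\<bar>Y T\<bar>\<close>, whatever the
  partition.\<close>

lemma deterministic_decomposition_variation_bound:
  fixes M :: "'a measure" and p :: "nat \<Rightarrow> real"
  assumes basis: "stochastic_basis M F" and Y: "martingale M F Y" and A: "adapted F A"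
    and \<tau>: "ext_stopping_time F \<tau>"
    and decomp: "\<And>t \<omega>. 0 \<le> t \<Longrightarrow> \<omega> \<in> space M \<Longrightarrow> ennreal t < \<tau> \<omega> \<Longrightarrow> g t = Y t \<omega> + A t \<omega>"
    and C: "\<And>t. t \<in> {0..T} \<Longrightarrow> \<bar>g t\<bar> \<le> C" and "0 \<le> K"
    and p: "mono_on {..n} p" "p ` {..n} \<subseteq> {0..T}"
    and E: "E \<in> sets M" and E_tau: "\<And>\<omega>. \<omega> \<in> E \<Longrightarrow> ennreal (p n) < \<tau> \<omega>"
    and E_K: "\<And>\<omega>. \<omega> \<in> E \<Longrightarrow> \<bar>A (p 0) \<omega>\<bar> + (\<Sum>j<n. \<bar>A (p (Suc j)) \<omega> - A (p j) \<omega>\<bar>) \<le> K"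
  shows "measure M E * (\<Sum>i<n. \<bar>g (p (Suc i)) - g (p i)\<bar>) \<le> 2 * K + C + (\<integral>\<omega>. \<bar>Y T \<omega>\<bar> \<partial>M)"
proof -
  interpret stochastic_basis M F by fact
  have mono: "p i \<le> p j" if "i \<le> j" "j \<le> n" for i j
    by (rule mono_onD[OF p(1)]) (use that in auto)
  have range: "0 \<le> p i" "p i \<le> T" if "i \<le> n" for i
    using subsetD[OF p(2) imageI, of i] that by simp_all
  have space: "space (F t) = space M" for t by (rule space_F)
  have sets: "sets (F t) \<subseteq> sets M" if "0 \<le> t" for t
    using subalgebra_F[OF that] by (simp add: subalgebra_def)
  have int: "integrable M (Y t)" if "0 \<le> t" for t
    using Y that by (auto simp: martingale_def)
  define V where "V i \<omega> = \<bar>A (p 0) \<omega>\<bar> + (\<Sum>j<i. \<bar>A (p (Suc j)) \<omega> - A (p j) \<omega>\<bar>)" for i \<omega>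
  \<comment> \<open>With the strict inequality, \<open>H i\<close> is known at time
    \<open>p i\<close>: \<open>ennreal (p i) < \<tau> \<omega>\<close> is the complement of the
    event in \<open>ext_stopping_time\<close>.\<close>
  define H where "H i = {\<omega> \<in> space M. ennreal (p i) < \<tau> \<omega> \<and> V i \<omega> \<le> K}" for i
  define \<sigma> where "\<sigma> i = sgn (g (p (Suc i)) - g (p i))" for i
  define S where "S = (\<Sum>i<n. \<bar>g (p (Suc i)) - g (p i)\<bar>)"
  have "0 \<le> S" by (auto simp: S_def intro: sum_nonneg)
  have H_F: "H i \<in> sets (F (p i))" if "i \<le> n" for i
  proof -
    have A_F: "A (p j) \<in> borel_measurable (F (p i))" if "j \<le> i" for j
    proof (rule measurable_from_subalg[of _ "F (p j)"])
      show "subalgebra (F (p i)) (F (p j))"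
        using sets_F_mono[of "p j" "p i"] mono[of j i] that \<open>i \<le> n\<close> by (simp add: subalgebra_def space)
      show "A (p j) \<in> borel_measurable (F (p j))"
        using A range[of j] that \<open>i \<le> n\<close> by (simp add: adapted_def)
    qed
    have "V i \<in> borel_measurable (F (p i))"
      unfolding V_def using A_F
      by (intro borel_measurable_add borel_measurable_sum borel_measurable_abs borel_measurable_diff) auto
    moreover have "Measurable.pred (F (p i)) (\<lambda>\<omega>. \<tau> \<omega> \<le> ennreal (p i))"
      using \<tau> range[OF \<open>i \<le> n\<close>] by (simp add: ext_stopping_time_def)
    ultimately have "{\<omega> \<in> space (F (p i)). \<not> \<tau> \<omega> \<le> ennreal (p i) \<and> V i \<omega> \<le> K} \<in> sets (F (p i))"
      by measurable
    then show ?thesis by (simp add: H_def space not_le)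
  qed
  have H_M: "H i \<in> sets M" if "i \<le> n" for i
    using H_F[OF that] sets range(1)[OF that] by blast
  have H_dec: "H (Suc i) \<subseteq> H i" if "i < n" for i
  proof -
    have "ennreal (p i) \<le> ennreal (p (Suc i))"
      using mono[of i "Suc i"] that by (intro ennreal_leI) simp
    then show ?thesis by (auto simp: H_def V_def intro: order.strict_trans1)
  qed
  have int_ind: "integrable M (\<lambda>\<omega>. indicator D \<omega> * h \<omega>)"
    if "D \<in> sets M" "integrable M h" for D and h :: "'a \<Rightarrow> real"
    using integrable_mult_indicator[of D M h] that by simp
  \<comment> \<open>\<open>I1 i\<close> is an increment of the transform, with mean zero;
    \<open>I2 i\<close> is the corresponding exit term.\<close>
  define I1 where "I1 i \<omega> = \<sigma> i * (indicator (H i) \<omega> * Y (p (Suc i)) \<omega> - indicator (H i) \<omega> * Y (p i) \<omega>)"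
    for i \<omega>
  define I2 where "I2 i \<omega> = indicator (H i - H (Suc i)) \<omega> * \<bar>Y (p (Suc i)) \<omega>\<bar>" for i \<omega>
  have I1: "integrable M (I1 i)" "integral\<^sup>L M (I1 i) = 0" if "i < n" for i
  proof -
    have *: "integrable M (\<lambda>\<omega>. indicator (H i) \<omega> * Y (p (Suc i)) \<omega>)"
      "integrable M (\<lambda>\<omega>. indicator (H i) \<omega> * Y (p i) \<omega>)"
      using that H_M[of i] int range[of i] range[of "Suc i"] by (auto intro: int_ind)
    then show "integrable M (I1 i)" unfolding I1_def by simp
    show "integral\<^sup>L M (I1 i) = 0"
      unfolding I1_def
      using * martingale_set_integral[OF basis Y range(1)[of i] mono[of i "Suc i"] H_F[of i]] that by simp
  qed
  have I2: "integrable M (I2 i)"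
    "integral\<^sup>L M (I2 i) \<le> (\<integral>\<omega>. indicator (H i - H (Suc i)) \<omega> * \<bar>Y T \<omega>\<bar> \<partial>M)" if "i < n" for i
  proof -
    have "sets (F (p i)) \<subseteq> sets (F (p (Suc i)))"
      using mono[of i "Suc i"] that by (intro sets_F_mono) simp
    \<comment> \<open>The exit is recognised only at time \<open>p (Suc i)\<close>, which is also
      the time at which \<open>I2 i\<close> evaluates \<open>Y\<close>; the comparison with
      \<open>Y T\<close> starts there.\<close>
    then have D: "H i - H (Suc i) \<in> sets (F (p (Suc i)))"
      using H_F[of i] H_F[of "Suc i"] that by auto
    then show "integral\<^sup>L M (I2 i) \<le> (\<integral>\<omega>. indicator (H i - H (Suc i)) \<omega> * \<bar>Y T \<omega>\<bar> \<partial>M)"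
      unfolding I2_def using range[of "Suc i"] that
      by (intro martingale_set_integral_abs_le[OF basis Y]) auto
    show "integrable M (I2 i)"
      unfolding I2_def using that H_M[of i] H_M[of "Suc i"] int range[of "Suc i"]
      by (auto intro!: int_ind)
  qed
  have YT: "integrable M (\<lambda>\<omega>. \<bar>Y T \<omega>\<bar>)"
    using int[of T] range[of 0] by auto
  have pathwise: "indicator E \<omega> * S - (2 * K + C) \<le> (\<Sum>i<n. I1 i \<omega>) + (\<Sum>i<n. I2 i \<omega>)"
    if \<omega>: "\<omega> \<in> space M" for \<omega>
  proof -
    \<comment> \<open>\<open>E\<close> enters only through its inclusion in \<open>H n\<close>, so
      it may be any event of \<open>M\<close>.\<close>
    have "indicator E \<omega> * S \<le> of_bool (\<omega> \<in> H n) * S"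
      using E_tau E_K \<omega> \<open>0 \<le> S\<close> by (auto simp: H_def V_def indicator_def)
    also have "of_bool (\<omega> \<in> H n) * S - (2 * K + C) \<le>
        (\<Sum>i<n. of_bool (\<omega> \<in> H i) * (sgn (g (p (Suc i)) - g (p i)) * (Y (p (Suc i)) \<omega> - Y (p i) \<omega>)))
        + (\<Sum>i<n. of_bool (\<omega> \<in> H i \<and> \<omega> \<notin> H (Suc i)) * \<bar>Y (p (Suc i)) \<omega>\<bar>)"
      unfolding S_def
    proof (rule transform_lower_bound[where a = "\<lambda>i. A (p i) \<omega>"])
      show "\<omega> \<in> H i" if "i < n" "\<omega> \<in> H (Suc i)" for i
        using H_dec that by blast
      show "g (p i) = Y (p i) \<omega> + A (p i) \<omega>" if "i \<le> n" "\<omega> \<in> H i" for i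
        using that range[of i] \<omega> by (intro decomp) (auto simp: H_def)
      show "\<bar>g (p i)\<bar> \<le> C" if "i \<le> n" for i
        using that range[of i] by (intro C) simp
      show "\<bar>A (p 0) \<omega>\<bar> + (\<Sum>j<i. \<bar>A (p (Suc j)) \<omega> - A (p j) \<omega>\<bar>) \<le> K" if "i \<le> n" "\<omega> \<in> H i" for i
        using that by (simp add: H_def V_def)
    qed fact
    also have "\<dots> = (\<Sum>i<n. I1 i \<omega>) + (\<Sum>i<n. I2 i \<omega>)"
      by (intro arg_cong2[where f = "(+)"] sum.cong) (auto simp: I1_def I2_def \<sigma>_def indicator_def algebra_simps)
    finally show ?thesis by simp
  qed
  have ES: "integrable M (\<lambda>\<omega>. indicator E \<omega> * S)"
    using E by (intro int_ind) auto
  have "measure M E * S - (2 * K + C) = (\<integral>\<omega>. indicator E \<omega> * S - (2 * K + C) \<partial>M)"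
    using E ES by (subst Bochner_Integration.integral_diff) (auto simp: prob_space)
  also have "\<dots> \<le> (\<integral>\<omega>. (\<Sum>i<n. I1 i \<omega>) + (\<Sum>i<n. I2 i \<omega>) \<partial>M)"
    using I1(1) I2(1) ES pathwise
    by (intro integral_mono Bochner_Integration.integrable_add Bochner_Integration.integrable_sum
        Bochner_Integration.integrable_diff) auto
  also have "\<dots> = (\<Sum>i<n. integral\<^sup>L M (I2 i))"
  proof -
    have "integrable M (\<lambda>\<omega>. \<Sum>i<n. I1 i \<omega>)" "integrable M (\<lambda>\<omega>. \<Sum>i<n. I2 i \<omega>)"
      using I1(1) I2(1) by (auto intro!: Bochner_Integration.integrable_sum)
    moreover have "(\<integral>\<omega>. (\<Sum>i<n. I1 i \<omega>) \<partial>M) = (\<Sum>i<n. integral\<^sup>L M (I1 i))"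
      using I1(1) by (intro Bochner_Integration.integral_sum) simp
    moreover have "(\<integral>\<omega>. (\<Sum>i<n. I2 i \<omega>) \<partial>M) = (\<Sum>i<n. integral\<^sup>L M (I2 i))"
      using I2(1) by (intro Bochner_Integration.integral_sum) simp
    ultimately show ?thesis using I1(2) by simp
  qed
  also have "\<dots> \<le> (\<Sum>i<n. \<integral>\<omega>. indicator (H i - H (Suc i)) \<omega> * \<bar>Y T \<omega>\<bar> \<partial>M)"
    using I2(2) by (intro sum_mono) simp
  also have "\<dots> = (\<integral>\<omega>. (\<Sum>i<n. indicator (H i - H (Suc i)) \<omega> * \<bar>Y T \<omega>\<bar>) \<partial>M)"
    using H_M YT by (intro Bochner_Integration.integral_sum[symmetric] int_ind) auto
  also have "\<dots> \<le> (\<integral>\<omega>. \<bar>Y T \<omega>\<bar> \<partial>M)"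
  proof (intro integral_mono)
    show "integrable M (\<lambda>\<omega>. \<Sum>i<n. indicator (H i - H (Suc i)) \<omega> * \<bar>Y T \<omega>\<bar>)"
      using H_M YT by (intro Bochner_Integration.integrable_sum int_ind) auto
    fix \<omega>
    \<comment> \<open>As \<open>H\<close> decreases, the exit indicators are differences and
      telescope.\<close>
    have "(\<Sum>i<n. indicator (H i - H (Suc i)) \<omega>) = (\<Sum>i<n. indicator (H i) \<omega> - indicator (H (Suc i)) \<omega> :: real)"
      using H_dec by (intro sum.cong) (auto simp: indicator_def)
    also have "\<dots> \<le> 1"
      by (subst sum_lessThan_telescope') (auto simp: indicator_def)
    finally show "(\<Sum>i<n. indicator (H i - H (Suc i)) \<omega> * \<bar>Y T \<omega>\<bar>) \<le> \<bar>Y T \<omega>\<bar>"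
      unfolding sum_distrib_right[symmetric] by (intro mult_left_le_one_le) (auto intro: sum_nonneg)
  qed fact
  finally show ?thesis by (simp add: S_def)
qed

section \<open>Semimartingales and finite variation for deterministic paths\<close>

text \<open>If the variation were infinite, choose a partition with sum above \<open>k\<close> for
  every \<open>k\<close>. On \<open>E K\<close> the variation bound applies to all of them with one
  constant, so \<open>E K\<close> is null for each \<open>K\<close>; yet almost every
  \<open>\<omega>\<close> lies in some \<open>E K\<close>.\<close>

lemma semimartingale_imp_finite_variation:
  assumes basis: "stochastic_basis M F" and f: "cadlag f"
    and semi: "semimartingale M F (\<lambda>t \<omega>. f t)"
  shows "finite_variation f"
proof (rule ccontr)
  interpret stochastic_basis M F by fact
  assume "\<not> finite_variation f"
  then obtain T where "0 \<le> T" and unbdd: "\<not> bdd_above (partition_sums f T)"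
    by (auto simp: finite_variation_def)
  have "\<exists>n p. mono_on {..n} p \<and> p ` {..n} \<subseteq> {0..T} \<and> real k < (\<Sum>i<n. \<bar>f (p (Suc i)) - f (p i)\<bar>)" for k
  proof -
    obtain z where "z \<in> partition_sums f T" "real k < z"
      using unbdd unfolding bdd_above_def by (meson not_le)
    then show ?thesis by blast
  qed
  then obtain N p where p: "\<And>k. mono_on {..N k} (p k)" "\<And>k. p k ` {..N k} \<subseteq> {0..T}"
    and large: "\<And>k. real k < (\<Sum>i<N k. \<bar>f (p k (Suc i)) - f (p k i)\<bar>)"
    by metis
  have range: "0 \<le> p k i" "p k i \<le> T" if "i \<le> N k" for k i
    using subsetD[OF p(2) imageI, of i k] that by simp_all
  from semi obtain L A where L: "local_martingale M F L" and A: "finite_variation_process M F A"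
    and zero: "\<And>\<omega>. \<omega> \<in> space M \<Longrightarrow> A 0 \<omega> = 0"
    and decomp: "\<And>t \<omega>. 0 \<le> t \<Longrightarrow> \<omega> \<in> space M \<Longrightarrow> f t = f 0 + L t \<omega> + A t \<omega>"
    unfolding semimartingale_def by blast
  have adA: "adapted F A" and varA: "\<And>\<omega>. \<omega> \<in> space M \<Longrightarrow> finite_variation (\<lambda>t. A t \<omega>)"
    using A by (auto simp: finite_variation_process_def)
  from L obtain \<tau> where \<tau>: "\<And>k. ext_stopping_time F (\<tau> k)"
    and inc: "\<And>\<omega>. \<omega> \<in> space M \<Longrightarrow> incseq (\<lambda>k. \<tau> k \<omega>)"
    and lim: "AE \<omega> in M. (\<lambda>k. \<tau> k \<omega>) \<longlonglongrightarrow> \<infinity>"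
    and mart: "\<And>k. martingale M F (stopped L (\<tau> k))"
    unfolding local_martingale_def by blast
  define V where "V k \<omega> = \<bar>A (p k 0) \<omega>\<bar> + (\<Sum>j<N k. \<bar>A (p k (Suc j)) \<omega> - A (p k j) \<omega>\<bar>)" for k \<omega>
  \<comment> \<open>Bounding the variation of \<open>A\<close> only along the countably many chosen
    partitions keeps \<open>E K\<close> measurable.\<close>
  define E where "E K = {\<omega> \<in> space M. \<not> \<tau> K \<omega> \<le> ennreal T \<and> (\<forall>k. V k \<omega> \<le> real K)}" for K :: nat
  have sub: "subalgebra M (F t)" if "0 \<le> t" for t
    using that by (rule subalgebra_F)
  have E_M: "E K \<in> sets M" for K
  proof -
    have A_M: "A t \<in> borel_measurable M" if "0 \<le> t" for t
      using measurable_from_subalg[OF sub[OF that]] adA that by (auto simp: adapted_def)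
    have "V k \<in> borel_measurable M" for k
      unfolding V_def using range
      by (intro borel_measurable_add borel_measurable_sum borel_measurable_abs borel_measurable_diff A_M) auto
    moreover have "Measurable.pred M (\<lambda>\<omega>. \<tau> K \<omega> \<le> ennreal T)"
      using measurable_from_subalg[OF sub[OF \<open>0 \<le> T\<close>]] \<tau>[of K] \<open>0 \<le> T\<close> by (auto simp: ext_stopping_time_def)
    ultimately show ?thesis unfolding E_def by measurable
  qed
  have null: "AE \<omega> in M. \<omega> \<notin> E K" for K
  proof -
    obtain C where C: "\<And>t. t \<in> {0..T} \<Longrightarrow> \<bar>f t - f 0\<bar> \<le> C"
      using cadlag_bounded[OF cadlag_diff_const[OF f] \<open>0 \<le> T\<close>] by metis
    define c where "c = 2 * real K + C + (\<integral>\<omega>. \<bar>stopped L (\<tau> K) T \<omega>\<bar> \<partial>M)"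
    have stopped: "stopped L (\<tau> K) t \<omega> = L t \<omega>" if "0 \<le> t" "ennreal t < \<tau> K \<omega>" for t \<omega>
      using that by (simp add: stopped_def min_absorb1[OF less_imp_le])
    have bound: "measure M (E K) * real k \<le> c" for k
    proof -
      have "measure M (E K) * real k
          \<le> measure M (E K) * (\<Sum>i<N k. \<bar>(f (p k (Suc i)) - f 0) - (f (p k i) - f 0)\<bar>)"
        using large[of k] by (intro mult_left_mono) auto
      also have "\<dots> \<le> c"
        unfolding c_def
      proof (rule deterministic_decomposition_variation_bound[OF basis mart adA \<tau> _ _ _ p(1,2) E_M])
        show "f t - f 0 = stopped L (\<tau> K) t \<omega> + A t \<omega>"
          if "0 \<le> t" "\<omega> \<in> space M" "ennreal t < \<tau> K \<omega>" for t \<omega>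
          using decomp[OF that(1,2)] stopped[OF that(1,3)] by simp
        show "\<bar>f t - f 0\<bar> \<le> C" if "t \<in> {0..T}" for t
          using C[OF that] .
        fix \<omega> assume \<omega>: "\<omega> \<in> E K"
        have "ennreal (p k (N k)) \<le> ennreal T"
          using range by (intro ennreal_leI) simp
        then show "ennreal (p k (N k)) < \<tau> K \<omega>"
          using \<omega> by (auto simp: E_def not_le intro: order.strict_trans1)
        show "\<bar>A (p k 0) \<omega>\<bar> + (\<Sum>j<N k. \<bar>A (p k (Suc j)) \<omega> - A (p k j) \<omega>\<bar>) \<le> real K"
          using \<omega> by (simp add: E_def V_def)
      qed simp
      finally show ?thesis .
    qed
    have "measure M (E K) = 0"
    proof (rule ccontr)
      assume "measure M (E K) \<noteq> 0"
      then have "0 < measure M (E K)" by (simp add: zero_less_measure_iff)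
      then obtain k :: nat where "c < real k * measure M (E K)"
        using reals_Archimedean3 by blast
      with bound[of k] show False by (simp add: mult.commute)
    qed
    then have "E K \<in> null_sets M"
      using E_M by (intro null_setsI) (simp_all add: emeasure_eq_measure)
    then show ?thesis by (rule AE_not_in)
  qed
  have "AE \<omega> in M. \<forall>K. \<omega> \<notin> E K"
    using null by (simp add: AE_all_countable)
  then have "AE \<omega> in M. False"
    using lim AE_space
  proof eventually_elim
    case (elim \<omega>)
    have "bdd_above (partition_sums (\<lambda>t. A t \<omega>) T)"
      using varA[OF elim(3)] \<open>0 \<le> T\<close> by (simp add: finite_variation_def)
    then obtain B where "\<forall>z\<in>partition_sums (\<lambda>t. A t \<omega>) T. z \<le> B"
      unfolding bdd_above_def ..
    note B = bspec[OF this]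
    have V: "V k \<omega> \<le> 2 * B" for k
    proof -
      \<comment> \<open>The one-step partition from \<open>0\<close> to \<open>p k 0\<close>: as
        \<open>A\<close> starts at zero, it bounds the initial term of \<open>V k\<close>, whence
        \<open>2 * B\<close>.\<close>
      define q where "q i = (if i = 0 then 0 else p k 0)" for i :: nat
      have q: "(\<Sum>j<1. \<bar>A (q (Suc j)) \<omega> - A (q j) \<omega>\<bar>) \<in> partition_sums (\<lambda>t. A t \<omega>) T"
        using range[of 0 k] by (intro CollectI exI[of _ 1] exI[of _ q]) (auto simp: q_def mono_on_def)
      have "\<bar>A (p k 0) \<omega>\<bar> \<le> B" using B[OF q] zero[OF elim(3)] by (simp add: q_def)
      moreover have "(\<Sum>j<N k. \<bar>A (p k (Suc j)) \<omega> - A (p k j) \<omega>\<bar>) \<le> B"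
        by (intro B CollectI exI[of _ "N k"] exI[of _ "p k"] conjI refl p)
      ultimately show ?thesis by (simp add: V_def)
    qed
    have "eventually (\<lambda>k. ennreal T < \<tau> k \<omega>) sequentially"
      using elim(2) by (rule order_tendstoD) simp
    moreover have "eventually (\<lambda>k. 2 * B \<le> real k) sequentially"
      using filterlim_real_sequentially by (simp add: filterlim_at_top)
    ultimately have "eventually (\<lambda>k. ennreal T < \<tau> k \<omega> \<and> 2 * B \<le> real k) sequentially"
      by (rule eventually_conj)
    then obtain K where K: "ennreal T < \<tau> K \<omega>" "2 * B \<le> real K"
      unfolding eventually_sequentially by auto
    have "V k \<omega> \<le> real K" for k
      using V[of k] K(2) by linarith
    with K(1) elim(3) have "\<omega> \<in> E K" by (simp add: E_def not_le)
    with elim(1) show False by blast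
  qed
  then show False by simp
qed

text \<open>Take \<open>L = 0\<close>, localised by infinite stopping times, and
  \<open>A = f - f 0\<close>, which is adapted because it is constant in
  \<open>\<omega>\<close>.\<close>

lemma finite_variation_imp_semimartingale:
  assumes basis: "stochastic_basis M F" and f: "cadlag f" "finite_variation f"
  shows "semimartingale M F (\<lambda>t \<omega>. f t)"
proof -
  interpret stochastic_basis M F by fact
  have cadlag0: "cadlag (\<lambda>_. 0)" by (auto simp: cadlag_def)
  have mart0: "martingale M F (\<lambda>_ _. 0)"
  proof -
    have "AE \<omega> in M. real_cond_exp M (F s) (\<lambda>_. 0) \<omega> = 0" if "0 \<le> s" for s
    proof -
      interpret finite_measure_subalgebra M "F s"
        using subalgebra_F[OF that] by unfold_locales
      show ?thesis by (rule real_cond_exp_F_meas) auto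
    qed
    then show ?thesis using cadlag0 by (auto simp: martingale_def adapted_def)
  qed
  have "local_martingale M F (\<lambda>_ _. 0)"
    unfolding local_martingale_def
  proof (intro conjI exI[of _ "\<lambda>_ _. \<infinity>"])
    show "\<forall>n::nat. martingale M F (stopped (\<lambda>_ _. 0) (\<lambda>_. \<infinity>))"
      using mart0 by (simp add: stopped_def[abs_def])
    show "\<forall>n::nat. ext_stopping_time F (\<lambda>_. \<infinity>)"
      by (auto simp: ext_stopping_time_def)
  qed (use cadlag0 in \<open>auto simp: adapted_def incseq_def\<close>)
  moreover have "finite_variation_process M F (\<lambda>t _. f t - f 0)"
    using cadlag_diff_const[OF f(1)] f(2)
    by (simp add: finite_variation_process_def adapted_def finite_variation_def)
  ultimately show ?thesis
    unfolding semimartingale_def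
    by (intro conjI exI[of _ "\<lambda>_ _. 0"] exI[of _ "\<lambda>t _. f t - f 0"]) auto
qed

theorem theorem4p3:
  fixes M :: "'a measure" and F :: "real \<Rightarrow> 'a measure"
    and X :: "real \<Rightarrow> real \<Rightarrow> real"
  assumes "stochastic_basis M F"
    and "deterministic_markov_process X"
    and "\<And>x. cadlag (X x)"
  shows "deterministic_semimartingale M F X \<longleftrightarrow> (\<forall>x. locally_summable_jumps (X x))"
  unfolding deterministic_semimartingale_def
proof (intro iff_allI iffI)
  fix x
  show "locally_summable_jumps (X x)" if "semimartingale M F (\<lambda>t \<omega>. X x t)"
    using semimartingale_imp_finite_variation[OF assms(1,3) that]
    by (rule finite_variation_imp_summable_jumps[OF assms(3)])
  show "semimartingale M F (\<lambda>t \<omega>. X x t)" if "locally_summable_jumps (X x)"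
    using markov_summable_jumps_imp_finite_variation[OF assms(2,3) that]
    by (rule finite_variation_imp_semimartingale[OF assms(1,3)])
qed

end
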